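(* Let $G$ be a $d$-regular graph on $n$ vertices with $d\geq 1$, and let $\lambda$ be the smallest eigenvalue of its adjacency matrix. Let $0<\varepsilon\leq n/d$, and put \[f=\left(1+\frac{1}{\varepsilon}\right)\frac{n}{d-\lambda}\ln\left(\left(\frac{1}{1+\varepsilon}\right)\frac{d-\lambda}{-\lambda}\right),\qquad \alpha=\frac{-n\lambda}{d-\lambda}.\] Then the number of independent sets of $G$ of size $m\geq f$ is at most \[\binom{n}{f}\binom{(1+\varepsilon)\alpha}{m-f}.\]
   Context: Following the paper's convention, rounding of non-integer quantities (such as $f$ and $(1+\varepsilon)\alpha$) is ignored; binomial coefficients with real upper argument $x$ are understood as $\binom{x}{k}=x(x-1)\cdots(x-k+1)/k!$.
   Formalization: f is rounded up to an integer (to 0 if negative), and the binomial coefficient with real upper argument x and lower argument k is taken to be 0 when x < k−1, since the bare product can be negative there (e.g. K_2, ε=1/2, m=4). *)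

theory Defs
  imports "HOL-Analysis.Analysis"
begin

text \<open>
  A finite simple graph is an irreflexive symmetric adjacency relation on a finite type
  of vertices; the vertex set is the whole type, so the graph has \<open>CARD('v)\<close> vertices.
\<close>

definition simple_graph :: "('v::finite \<Rightarrow> 'v \<Rightarrow> bool) \<Rightarrow> bool" where
  "simple_graph E \<longleftrightarrow> symp E \<and> irreflp E"

definition regular_graph :: "nat \<Rightarrow> ('v::finite \<Rightarrow> 'v \<Rightarrow> bool) \<Rightarrow> bool" where
  "regular_graph d E \<longleftrightarrow> simple_graph E \<and> (\<forall>v. card {u. E v u} = d)"

definition independent_set :: "('v::finite \<Rightarrow> 'v \<Rightarrow> bool) \<Rightarrow> 'v set \<Rightarrow> bool" where
  "independent_set E S \<longleftrightarrow> (\<forall>u\<in>S. \<forall>v\<in>S. \<not> E u v)"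

definition adjacency_matrix :: "('v::finite \<Rightarrow> 'v \<Rightarrow> bool) \<Rightarrow> real ^ 'v ^ 'v" where
  "adjacency_matrix E = (\<chi> i j. if E i j then 1 else 0)"

text \<open>Adjacency matrices are symmetric, so restricting to real eigenvalues loses nothing.\<close>

definition matrix_eigenvalue :: "real ^ 'n ^ 'n \<Rightarrow> real \<Rightarrow> bool" where
  "matrix_eigenvalue A \<mu> \<longleftrightarrow> (\<exists>x. x \<noteq> 0 \<and> A *v x = \<mu> *s x)"

definition smallest_eigenvalue :: "real ^ 'n ^ 'n \<Rightarrow> real \<Rightarrow> bool" where
  "smallest_eigenvalue A \<mu> \<longleftrightarrow>
     matrix_eigenvalue A \<mu> \<and> (\<forall>\<nu>. matrix_eigenvalue A \<nu> \<longrightarrow> \<mu> \<le> \<nu>)"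

text \<open>
  The binomial coefficient \<open>x (x - 1) \<dots> (x - k + 1) / k!\<close> with real upper argument, with the
  usual counting convention that it vanishes for \<open>x < k - 1\<close>. In that range the bare product
  has factors of both signs and may be negative (e.g. \<open>x = 3/2\<close>, \<open>k = 3\<close>), so that it cannot
  serve as an upper bound for a cardinality.
\<close>

definition real_binomial :: "real \<Rightarrow> nat \<Rightarrow> real" where
  "real_binomial x k = (if real k - 1 \<le> x then x gchoose k else 0)"

lemma real_binomial_of_nat: "real_binomial (real n) k = real (n choose k)"
  by (auto simp: real_binomial_def binomial_gbinomial[symmetric])

end

theory Submission
  imports Defs
begin

text \<open>
  Let \<open>x = (1 + \<epsilon>) \<alpha>\<close>. Applying the variational characterisation of \<open>\<lambda>\<close> to the centred indicator
  vector of \<open>U\<close> shows that every \<open>U\<close> with more than \<open>x\<close> vertices contains a vertex with at least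
  \<open>\<beta> |U|\<close> neighbours in \<open>U\<close>, where \<open>\<beta> = \<epsilon> (d - \<lambda>) / ((1 + \<epsilon>) n)\<close>. Splitting the independent
  subsets of \<open>U\<close> according to whether they contain this vertex gives a Pascal-type recursion; each
  time the vertex is taken the ambient set shrinks by the factor \<open>1 - \<beta> \<le> exp (- \<beta>)\<close>, and
  \<open>f\<close> is chosen such that \<open>n exp (- \<beta> f) = x\<close>.
\<close>

section \<open>The smallest eigenvalue and the quadratic form\<close>

text \<open>By compactness the form attains its minimum \<open>\<mu>\<close> on the unit sphere. A
  first-variation argument shows that the minimiser is an eigenvector, so \<open>\<mu>\<close> is an
  eigenvalue and hence at least \<open>lam\<close>.\<close>

lemma smallest_eigenvalue_le_quadratic_form:
  fixes A :: "real ^ 'n ^ 'n"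
  assumes sym: "transpose A = A" and small: "smallest_eigenvalue A lam"
  shows "lam * (y \<bullet> y) \<le> y \<bullet> (A *v y)"
proof -
  have self_adj: "u \<bullet> (A *v w) = (A *v u) \<bullet> w" for u w
    using sym by (metis dot_lmul_matrix vector_transpose_matrix)
  let ?S = "sphere (0 :: real ^ 'n) 1"
  have "\<exists>x\<in>?S. \<forall>u\<in>?S. x \<bullet> (A *v x) \<le> u \<bullet> (A *v u)"
    by (intro continuous_attains_inf continuous_on_inner continuous_on_id linear_continuous_on) auto
  then obtain x where x: "norm x = 1"
    and x_min: "\<And>u. norm u = 1 \<Longrightarrow> x \<bullet> (A *v x) \<le> u \<bullet> (A *v u)"
    by auto
  define \<mu> where "\<mu> = x \<bullet> (A *v x)"
  have form_ge: "\<mu> * (u \<bullet> u) \<le> u \<bullet> (A *v u)" for u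
  proof (cases "u = 0")
    case False
    have "\<mu> \<le> (u /\<^sub>R norm u) \<bullet> (A *v (u /\<^sub>R norm u))"
      unfolding \<mu>_def using False by (intro x_min) simp
    also have "\<dots> = (u \<bullet> (A *v u)) / (u \<bullet> u)"
      by (simp add: matrix_vector_mult_scaleR dot_square_norm power2_eq_square field_simps)
    finally show ?thesis
      using False by (simp add: pos_le_divide_eq)
  qed simp
  \<comment> \<open>The residual \<open>z\<close> is half the gradient at \<open>x\<close> of the
    nonnegative form sending \<open>u\<close> to
    \<open>u \<bullet> (A *v u) - \<mu> * (u \<bullet> u)\<close>. As this form vanishes at
    \<open>x\<close>, moving along \<open>z\<close> must not decrease it, which forces
    \<open>z = 0\<close>.\<close>
  define z where "z = A *v x - \<mu> *\<^sub>R x"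
  define c where "c = z \<bullet> (A *v z) - \<mu> * (z \<bullet> z)"
  have c_nonneg: "0 \<le> c"
    using form_ge[of z] by (simp add: c_def)
  have xx: "x \<bullet> x = 1"
    using x by (simp add: dot_square_norm)
  have var: "0 \<le> 2 * t * (z \<bullet> z) + t\<^sup>2 * c" for t
  proof -
    have "(x + t *\<^sub>R z) \<bullet> (A *v (x + t *\<^sub>R z)) - \<mu> * ((x + t *\<^sub>R z) \<bullet> (x + t *\<^sub>R z))
        = 2 * t * (z \<bullet> (A *v x) - \<mu> * (z \<bullet> x)) + t\<^sup>2 * c"
    proof -
      have "x \<bullet> (A *v z) = z \<bullet> (A *v x)" and "x \<bullet> z = z \<bullet> x"
        using self_adj[of x z] by (simp_all add: inner_commute)
      then show ?thesis
        using xx \<mu>_def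
        by (simp add: c_def matrix_vector_right_distrib matrix_vector_mult_scaleR
            inner_add_left inner_add_right power2_eq_square) (simp add: algebra_simps)
    qed
    moreover have "z \<bullet> (A *v x) - \<mu> * (z \<bullet> x) = z \<bullet> z"
      unfolding z_def by (simp add: inner_diff_right)
    ultimately show ?thesis
      using form_ge[of "x + t *\<^sub>R z"] by simp
  qed
  have "z = 0"
  proof (rule ccontr)
    assume "z \<noteq> 0"
    then have zz: "0 < z \<bullet> z"
      by simp
    \<comment> \<open>A negative \<open>t\<close> small enough for the linear term to dominate; the
      denominator is \<open>c + 1\<close> because \<open>c\<close> may be 0.\<close>
    define t where "t = - (z \<bullet> z) / (c + 1)"
    have "2 * t * (z \<bullet> z) + t\<^sup>2 * c = t * (z \<bullet> z) * (2 - c / (c + 1))"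
      by (simp add: t_def power2_eq_square right_diff_distrib)
    moreover have "t * (z \<bullet> z) < 0"
      using zz c_nonneg by (simp add: t_def mult_neg_pos divide_neg_pos)
    moreover have "0 < 2 - c / (c + 1)"
      using c_nonneg by (simp add: field_simps)
    ultimately show False
      using var[of t] by (metis mult_neg_pos not_less)
  qed
  then have "A *v x = \<mu> *s x"
    by (simp add: z_def scalar_mult_eq_scaleR)
  moreover have "x \<noteq> 0"
    using x by auto
  ultimately have "lam \<le> \<mu>"
    using small by (auto simp: smallest_eigenvalue_def matrix_eigenvalue_def)
  then have "lam * (y \<bullet> y) \<le> \<mu> * (y \<bullet> y)"
    by (simp add: mult_right_mono)
  then show ?thesis
    using form_ge[of y] by linarith
qed

section \<open>Spectral bounds for graphs\<close>

lemma transpose_adjacency_matrix: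
  "simple_graph E \<Longrightarrow> transpose (adjacency_matrix E) = adjacency_matrix E"
  by (auto simp: simple_graph_def adjacency_matrix_def transpose_def vec_eq_iff symp_def)

lemma inner_adjacency_matrix:
  "y \<bullet> (adjacency_matrix E *v y) = (\<Sum>v\<in>UNIV. \<Sum>w\<in>UNIV. y $ v * (if E v w then y $ w else 0))"
  by (simp add: inner_vec_def matrix_vector_mult_def adjacency_matrix_def sum_distrib_left
      if_distrib[of "\<lambda>a. a * _"] cong: if_cong)

text \<open>The difference of the two basis vectors at the ends of an edge has Rayleigh quotient -1.
  The theorem needs this for the signs of \<open>lam\<close>, \<open>d - lam\<close> and
  \<alpha>.\<close>

lemma smallest_eigenvalue_le_minus_one:
  assumes "simple_graph E" and small: "smallest_eigenvalue (adjacency_matrix E) lam"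
    and "E a b"
  shows "lam \<le> - 1"
proof -
  have irr: "\<not> E v v" and sym: "E v w \<Longrightarrow> E w v" for v w
    using assms(1) by (auto simp: simple_graph_def irreflp_def symp_def)
  have "a \<noteq> b"
    using irr \<open>E a b\<close> by auto
  let ?A = "adjacency_matrix E"
  define y where "y = axis a (1 :: real) - axis b 1"
  have col: "axis v (1 :: real) \<bullet> (?A *v axis w 1) = (if E v w then 1 else 0)" for v w
    by (simp add: inner_axis' matrix_vector_mult_basis column_def adjacency_matrix_def)
  have "y \<bullet> (?A *v y) = - 2"
    using irr \<open>E a b\<close> sym[OF \<open>E a b\<close>]
    by (simp add: y_def matrix_vector_mult_diff_distrib inner_diff_left inner_diff_right col)
  moreover have "y \<bullet> y = 2"
    using \<open>a \<noteq> b\<close>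
    by (simp add: y_def inner_diff_left inner_diff_right inner_axis_axis)
  ultimately show ?thesis
    using smallest_eigenvalue_le_quadratic_form[OF transpose_adjacency_matrix[OF assms(1)] small, of y]
    by simp
qed

text \<open>A one-sided expander mixing bound; for independent \<open>U\<close> the right-hand side
  is 0 and Hoffman's ratio bound results.\<close>

lemma sum_induced_degree_ge:
  fixes E :: "'v::finite \<Rightarrow> 'v \<Rightarrow> bool"
  assumes reg: "regular_graph d E"
    and small: "smallest_eigenvalue (adjacency_matrix E) lam"
  shows "(real d - lam) / CARD('v) * (real (card U))\<^sup>2 + lam * card U
           \<le> (\<Sum>v\<in>U. real (card {w\<in>U. E v w}))"
proof -
  define n where "n = real CARD('v)"
  define u where "u = real (card U)"
  \<comment> \<open>Subtracting the density \<open>s\<close> makes \<open>y\<close> orthogonal to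
    the all-ones vector, which by regularity is an eigenvector for \<open>d\<close>; this is what
    produces the term in \<open>d\<close>.\<close>
  define s where "s = u / n"
  define y :: "real ^ 'v" where "y = (\<chi> v. indicator U v - s)"
  let ?a = "\<lambda>v w. if E v w then 1 else (0 :: real)"
  have n: "0 < n"
    by (simp add: n_def)
  have simple: "simple_graph E" and deg: "card {w. E v w} = d" for v
    using reg by (auto simp: regular_graph_def)
  have E_sym: "E v w = E w v" for v w
    using simple by (auto simp: simple_graph_def symp_def)
  have ind: "(\<Sum>v\<in>UNIV. indicator U v) = u"
    by (simp add: u_def indicator_def)
  have row: "(\<Sum>w\<in>UNIV. ?a v w) = d" for v
    using deg[of v] by (simp add: sum.If_cases)
  have col: "(\<Sum>v\<in>UNIV. ?a v w) = d" for w
    using row[of w] by (simp add: E_sym)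
  have inner: "(\<Sum>v\<in>UNIV. \<Sum>w\<in>UNIV. indicator U v * indicator U w * ?a v w)
      = (\<Sum>v\<in>U. real (card {w\<in>U. E v w}))"
  proof -
    have "(\<Sum>w\<in>UNIV. indicator U v * indicator U w * ?a v w)
        = indicator U v * real (card {w\<in>U. E v w})" for v
    proof -
      have "(\<Sum>w\<in>UNIV. indicator U v * indicator U w * ?a v w)
          = (\<Sum>w\<in>UNIV. indicator U v * indicator {w\<in>U. E v w} w)"
        by (intro sum.cong) (auto simp: indicator_def)
      also have "\<dots> = indicator U v * real (card {w\<in>U. E v w})"
        by (simp add: sum_distrib_left[symmetric] indicator_def)
      finally show ?thesis .
    qed
    then show ?thesis
      by (simp add: indicator_def sum.If_cases)
  qed
  have rowU: "(\<Sum>v\<in>UNIV. \<Sum>w\<in>UNIV. indicator U v * ?a v w) = u * d"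
    by (simp add: sum_distrib_left[symmetric] row sum_distrib_right[symmetric] ind
        del: mult_cancel_left1)
  have colU: "(\<Sum>v\<in>UNIV. \<Sum>w\<in>UNIV. indicator U w * ?a v w) = u * d"
    by (subst sum.swap)
       (simp add: sum_distrib_left[symmetric] col sum_distrib_right[symmetric] ind)
  have tot: "(\<Sum>v\<in>UNIV. \<Sum>w\<in>UNIV. ?a v w) = n * d"
    by (simp only: row) (simp add: n_def)
  have "y \<bullet> (adjacency_matrix E *v y)
      = (\<Sum>v\<in>UNIV. \<Sum>w\<in>UNIV. indicator U v * indicator U w * ?a v w
           - s * (indicator U v * ?a v w) - s * (indicator U w * ?a v w) + s\<^sup>2 * ?a v w)"
    unfolding inner_adjacency_matrix
    by (intro sum.cong) (auto simp: y_def power2_eq_square algebra_simps)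
  also have "\<dots> = (\<Sum>v\<in>U. real (card {w\<in>U. E v w})) - s * (u * d) - s * (u * d) + s\<^sup>2 * (n * d)"
    by (simp only: sum.distrib sum_subtractf sum_distrib_left[where r = s, symmetric]
        sum_distrib_left[where r = "s\<^sup>2", symmetric] inner rowU colU tot)
  finally have form: "y \<bullet> (adjacency_matrix E *v y)
      = (\<Sum>v\<in>U. real (card {w\<in>U. E v w})) - d * u\<^sup>2 / n"
    using n by (simp add: s_def power2_eq_square)
  have "y \<bullet> y = (\<Sum>v\<in>UNIV. (1 - 2 * s) * indicator U v + s\<^sup>2)"
    unfolding inner_vec_def
    by (intro sum.cong) (auto simp: y_def indicator_def power2_eq_square algebra_simps)
  also have "\<dots> = (1 - 2 * s) * u + s\<^sup>2 * n"
    by (simp add: sum.distrib sum_distrib_left[symmetric] ind n_def)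
  finally have "y \<bullet> y = u - u\<^sup>2 / n"
    using n by (simp add: s_def power2_eq_square field_simps)
  then have "lam * (u - u\<^sup>2 / n) \<le> (\<Sum>v\<in>U. real (card {w\<in>U. E v w})) - d * u\<^sup>2 / n"
    using smallest_eigenvalue_le_quadratic_form[OF transpose_adjacency_matrix[OF simple] small, of y]
    by (simp add: form)
  then show ?thesis
    unfolding n_def[symmetric] u_def[symmetric] by (simp add: algebra_simps diff_divide_distrib)
qed

section \<open>Estimates for binomial coefficients\<close>

lemma real_binomial_nonneg: "0 \<le> real_binomial x k"
proof -
  have "0 \<le> x gchoose k" if "real k - 1 \<le> x"
    unfolding gbinomial_prod_rev using that
    by (intro divide_nonneg_nonneg prod_nonneg) auto
  then show ?thesis
    by (simp add: real_binomial_def)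
qed

text \<open>For \<open>k \<le> u\<close> the factors of the falling product are nonnegative and grow
  with the upper argument. For \<open>k > u\<close> the left side is 0, and the cutoff in
  \<open>real_binomial\<close> keeps the right side nonnegative.\<close>

lemma binomial_le_real_binomial:
  assumes "real u \<le> x"
  shows "real (u choose k) \<le> real_binomial x k"
proof (cases "k \<le> u")
  case True
  have "real u gchoose k \<le> x gchoose k"
    unfolding gbinomial_prod_rev using True assms
    by (intro divide_right_mono prod_mono) auto
  then show ?thesis
    using True assms by (auto simp: real_binomial_def binomial_gbinomial)
qed (simp add: real_binomial_nonneg binomial_eq_0)

text \<open>Every set of size \<open>q + k\<close> arises from at least one pair of a
  \<open>q\<close>-set and a disjoint \<open>k\<close>-set.\<close>

lemma binomial_add_le: "u choose (q + k) \<le> (u choose q) * (u choose k)"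
proof (cases "q + k \<le> u")
  case True
  have "u choose (q + k) \<le> (u choose (q + k)) * ((q + k) choose q)"
    by (simp add: Suc_leI)
  also have "\<dots> = (u choose q) * ((u - q) choose k)"
    using choose_mult[of q "q + k" u] True by simp
  also have "\<dots> \<le> (u choose q) * (u choose k)"
    by (intro mult_left_mono binomial_right_mono) auto
  finally show ?thesis .
qed (simp add: binomial_eq_0)

section \<open>The recursive count of independent sets\<close>

text \<open>Here \<open>q\<close> is a budget of vertices still to be taken: the third hypothesis
  says that spending it shrinks the ambient set to size at most \<open>x\<close>. Both branches of
  the recursion preserve it, so \<open>U\<close> and \<open>q\<close> vary in the induction while
  \<open>k\<close> is fixed.\<close>

lemma card_independent_sets_le:
  fixes E :: "'v::finite \<Rightarrow> 'v \<Rightarrow> bool" and x \<beta> :: real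
  assumes irr: "irreflp E"
    and dense: "\<And>U. x < card U \<Longrightarrow> \<exists>v\<in>U. \<beta> * card U \<le> card {w\<in>U. E v w}"
    and "card U * exp (- \<beta> * real q) \<le> x"
  shows "real (card {S. S \<subseteq> U \<and> independent_set E S \<and> card S = q + k})
           \<le> real (card U choose q) * real_binomial x k"
  using assms(3)
proof (induction "card U" arbitrary: U q rule: less_induct)
  case less
  let ?I = "\<lambda>U j. {S. S \<subseteq> U \<and> independent_set E S \<and> card S = j}"
  show ?case
  proof (cases "real (card U) \<le> x")
    \<comment> \<open>Once \<open>U\<close> is this small, independence is dropped and all subsets
      of the right size are counted.\<close>
    case True
    have "card (?I U (q + k)) \<le> card {S. S \<subseteq> U \<and> card S = q + k}"
      by (intro card_mono) auto
    also have "\<dots> = card U choose (q + k)"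
      by (simp add: n_subsets)
    also have "\<dots> \<le> (card U choose q) * (card U choose k)"
      by (rule binomial_add_le)
    finally have "real (card (?I U (q + k))) \<le> real (card U choose q) * real (card U choose k)"
      by (metis of_nat_le_iff of_nat_mult)
    also have "\<dots> \<le> real (card U choose q) * real_binomial x k"
      by (intro mult_left_mono binomial_le_real_binomial True) auto
    finally show ?thesis .
  next
    case False
    \<comment> \<open>With \<open>q = 0\<close> the hypothesis would read
      \<open>card U \<le> x\<close>.\<close>
    then obtain p where q: "q = Suc p"
      using less.prems by (cases q) auto
    obtain v where v: "v \<in> U" and v_deg: "\<beta> * card U \<le> card {w\<in>U. E v w}"
      using dense[of U] False by force
    \<comment> \<open>What remains available to an independent set once it contains
      \<open>v\<close>.\<close>
    define W where "W = U - {v} - {w\<in>U. E v w}"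
    have v_irr: "\<not> E v v"
      using irr by (auto simp: irreflp_def)
    have U: "card U = Suc (card (U - {v}))"
      using v by (metis card_Suc_Diff1 finite)
    have "W \<subseteq> U - {v}"
      by (auto simp: W_def)
    then have W_le: "card W \<le> card (U - {v})"
      by (intro card_mono) auto
    have "{w\<in>U. E v w} \<subseteq> U - {v}"
      using v_irr by auto
    then have "card W = card (U - {v}) - card {w\<in>U. E v w}"
      unfolding W_def by (intro card_Diff_subset) auto
    moreover have "card {w\<in>U. E v w} \<le> card (U - {v})"
      using \<open>{w\<in>U. E v w} \<subseteq> U - {v}\<close> by (intro card_mono) auto
    ultimately have "real (card W) \<le> (1 - \<beta>) * card U"
      using v_deg U by (simp add: algebra_simps)
    also have "\<dots> \<le> exp (- \<beta>) * card U"
      using exp_ge_add_one_self[of "- \<beta>"] by (intro mult_right_mono) auto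
    finally have "card W * exp (- \<beta> * real p) \<le> exp (- \<beta>) * card U * exp (- \<beta> * real p)"
      by (intro mult_right_mono) auto
    also have "\<dots> = card U * exp (- \<beta> * real q)"
      by (simp add: q exp_add[symmetric] algebra_simps)
    finally have W_small: "card W * exp (- \<beta> * real p) \<le> x"
      using less.prems by linarith
    have "card (U - {v}) * exp (- \<beta> * real q) \<le> card U * exp (- \<beta> * real q)"
      using U by (intro mult_right_mono) auto
    then have Uv_small: "card (U - {v}) * exp (- \<beta> * real q) \<le> x"
      using less.prems by linarith
    have split: "?I U (q + k) \<subseteq> ?I (U - {v}) (q + k) \<union> insert v ` ?I W (p + k)"
    proof
      fix S assume S: "S \<in> ?I U (q + k)"
      show "S \<in> ?I (U - {v}) (q + k) \<union> insert v ` ?I W (p + k)"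
      proof (cases "v \<in> S")
        case True
        have "S - {v} \<in> ?I W (p + k)"
          using S True by (auto simp: W_def independent_set_def q)
        moreover have "S = insert v (S - {v})"
          using True by auto
        ultimately show ?thesis
          by blast
      qed (use S in auto)
    qed
    have "card (?I U (q + k)) \<le> card (?I (U - {v}) (q + k) \<union> insert v ` ?I W (p + k))"
      by (intro card_mono split) auto
    also have "\<dots> \<le> card (?I (U - {v}) (q + k)) + card (?I W (p + k))"
      by (intro order.trans[OF card_Un_le] add_mono card_image_le) auto
    finally have "real (card (?I U (q + k)))
        \<le> real (card (?I (U - {v}) (q + k))) + real (card (?I W (p + k)))"
      by linarith
    also have "\<dots> \<le> real (card (U - {v}) choose q) * real_binomial x k
        + real (card W choose p) * real_binomial x k"
      using U W_le by (intro add_mono less.hyps Uv_small W_small) auto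
    \<comment> \<open>Enlarging \<open>W\<close> to \<open>U - {v}\<close> gives both terms the same
      upper argument, so that Pascal's rule applies.\<close>
    also have "\<dots> \<le> real (card (U - {v}) choose q) * real_binomial x k
        + real (card (U - {v}) choose p) * real_binomial x k"
      using W_le
      by (intro add_left_mono mult_right_mono real_binomial_nonneg)
         (simp add: binomial_right_mono)
    also have "\<dots> = real (card U choose q) * real_binomial x k"
      by (simp add: U q algebra_simps)
    finally show ?thesis .
  qed
qed

theorem theorem2p4:
  fixes E :: "'v::finite \<Rightarrow> 'v \<Rightarrow> bool"
    and n d m :: nat
    and lam \<epsilon> f \<alpha> :: real
  assumes "n = CARD('v)"
    and "regular_graph d E"
    and "d \<ge> 1"
    and "smallest_eigenvalue (adjacency_matrix E) lam"
    and "0 < \<epsilon>" and "\<epsilon> \<le> real n / real d"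
    and "f = (1 + 1 / \<epsilon>) * (real n / (real d - lam))
               * ln ((1 / (1 + \<epsilon>)) * ((real d - lam) / (- lam)))"
    and "\<alpha> = (- real n * lam) / (real d - lam)"
    and "real m \<ge> f"
  shows "real (card {S. independent_set E S \<and> card S = m})
           \<le> real (n choose nat \<lceil>f\<rceil>) * real_binomial ((1 + \<epsilon>) * \<alpha>) (m - nat \<lceil>f\<rceil>)"

\<comment> \<open>Choice of parameters and conclusion\<close>
proof -
  define x where "x = (1 + \<epsilon>) * \<alpha>"
  define \<beta> where "\<beta> = (real d - lam) / n * (\<epsilon> / (1 + \<epsilon>))"
  \<comment> \<open>Rounding up gives \<open>f \<le> q\<close>, also for negative \<open>f\<close>,
    where \<open>q = 0\<close>.\<close>
  define q where "q = nat \<lceil>f\<rceil>"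
  note eps = \<open>0 < \<epsilon>\<close>
  have n: "0 < real n"
    using assms(1) by simp
  have simple: "simple_graph E" and deg: "card {w. E v w} = d" for v
    using assms(2) by (auto simp: regular_graph_def)
  obtain a b where "E a b"
    using deg \<open>d \<ge> 1\<close> by (metis card.empty empty_Collect_eq not_one_le_zero)
  then have lam: "lam \<le> - 1"
    using smallest_eigenvalue_le_minus_one[OF simple assms(4)] by blast
  then have dl: "0 < real d - lam"
    by simp
  have dense: "\<exists>v\<in>U. \<beta> * card U \<le> card {w\<in>U. E v w}" if U: "x < card U" for U
  proof (rule ccontr)
    assume "\<not> ?thesis"
    then have less: "real (card {w\<in>U. E v w}) < \<beta> * card U" if "v \<in> U" for v
      using that by force
    have "0 < \<alpha>"
      using lam n dl by (auto simp: assms(8) intro!: divide_neg_pos mult_pos_neg)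
    \<comment> \<open>This makes \<open>U\<close> nonempty, as the strict comparison of sums below
      requires.\<close>
    then have "0 < x"
      using eps by (simp add: x_def)
    then have U_pos: "0 < real (card U)"
      using U by linarith
    \<comment> \<open>The right side is the spectral lower bound for the average degree inside
      \<open>U\<close>. Since \<open>card U\<close> exceeds
      \<open>(1 + \<epsilon>) * \<alpha>\<close>, the difference \<open>card U - \<alpha>\<close> is
      at least the fraction \<open>\<epsilon> / (1 + \<epsilon>)\<close> of \<open>card U\<close>;
      hence the choice of \<beta>.\<close>
    have "\<beta> * card U \<le> (real d - lam) / n * (card U - \<alpha>)"
    proof -
      have "\<alpha> \<le> card U / (1 + \<epsilon>)"
        using U eps by (simp add: x_def field_simps)
      then have "\<epsilon> / (1 + \<epsilon>) * card U \<le> card U - \<alpha>"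
        using eps by (simp add: field_simps)
      then show ?thesis
        using dl n unfolding \<beta>_def mult.assoc by (intro mult_left_mono) auto
    qed
    then have "card U * (\<beta> * card U) \<le> card U * ((real d - lam) / n * (card U - \<alpha>))"
      by (intro mult_left_mono) auto
    also have "\<dots> = (real d - lam) / n * (real (card U))\<^sup>2 + lam * card U"
    proof -
      have "(real d - lam) / n * \<alpha> = - lam"
        using n dl by (simp add: assms(8))
      then show ?thesis
        by (simp add: right_diff_distrib power2_eq_square distrib_left)
    qed
    also have "\<dots> \<le> (\<Sum>v\<in>U. real (card {w\<in>U. E v w}))"
      using sum_induced_degree_ge[OF assms(2,4), of U] by (simp add: assms(1))
    also have "\<dots> < (\<Sum>v\<in>U. \<beta> * card U)"
      using U_pos less by (intro sum_strict_mono) auto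
    finally show False
      by simp
  qed
  \<comment> \<open>The factor before the logarithm in \<open>f\<close> is exactly
    \<open>1 / \<beta>\<close>.\<close>
  have "\<beta> * ((1 + 1 / \<epsilon>) * (real n / (real d - lam))) = 1"
    using dl n eps by (simp add: \<beta>_def divide_simps)
  then have \<beta>_f: "\<beta> * f = ln ((1 / (1 + \<epsilon>)) * ((real d - lam) / (- lam)))"
    unfolding assms(7) by (simp only: mult.assoc[symmetric] mult_1_left)
  have "0 \<le> \<beta>"
    using dl eps by (simp add: \<beta>_def)
  then have "exp (- \<beta> * real q) \<le> exp (- (\<beta> * f))"
    using real_nat_ceiling_ge[of f] by (simp add: q_def mult_left_mono)
  also have "\<dots> = inverse ((1 / (1 + \<epsilon>)) * ((real d - lam) / (- lam)))"
    unfolding \<beta>_f exp_minus using dl eps lam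
    by (subst exp_ln) (auto intro!: divide_neg_neg divide_pos_neg mult_pos_neg)
  finally have "n * exp (- \<beta> * real q)
      \<le> n * inverse ((1 / (1 + \<epsilon>)) * ((real d - lam) / (- lam)))"
    by (intro mult_left_mono) auto
  also have "\<dots> = x"
    by (simp add: x_def assms(8))
  finally have "card (UNIV :: 'v set) * exp (- \<beta> * real q) \<le> x"
    by (simp add: assms(1))
  then have "real (card {S. S \<subseteq> UNIV \<and> independent_set E S \<and> card S = q + (m - q)})
      \<le> real (card (UNIV :: 'v set) choose q) * real_binomial x (m - q)"
    using simple by (intro card_independent_sets_le[OF _ dense]) (auto simp: simple_graph_def)
  \<comment> \<open>The truncated subtraction is exact, since the integer \<open>m\<close> is at
    least the ceiling of \<open>f\<close>.\<close>
  moreover have "q + (m - q) = m"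
    using \<open>real m \<ge> f\<close> by (simp add: q_def ceiling_le_iff nat_le_iff)
  ultimately show ?thesis
    by (simp add: x_def q_def assms(1))
qed

end
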